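(* For all natural numbers $m,n,k$ and every list $O$ of oracles, if $\mathrm{GP}(m,n,O)=\mathsf{yes}(m,k)$, then every sorting network on $m$ channels has size at least $k$, and there exists a sorting network on $m$ channels of size exactly $k$.
   Context: A comparator is a pair $(i,j)$ of natural numbers; a comparator network is a finite list of comparators, and its size is the number of comparators. $C_1;C_2$ denotes concatenation. A network is a network on $n$ channels if every comparator $(i,j)$ has $i<n$, $j<n$, $i\neq j$; it is standard on $n$ channels if every comparator has $i<j<n$. For $\vec x=(x_0,\ldots,x_{n-1})\in\{0,1\}^n$, applying comparator $(i,j)$ leaves $\vec x$ unchanged if $x_i\le x_j$ and otherwise swaps the entries at positions $i$ and $j$; $C(\vec x)$ applies the comparators of $C$ in order; $\mathsf{outputs}(C)=\{C(\vec x):\vec x\in\{0,1\}^n\}$. $C$ is a sorting network on $n$ channels if it is a network on $n$ channels and $C(\vec x)$ is nondecreasing for all $\vec x\in\{0,1\}^n$. A comparator $c=(i,j)$ is redundant after $C_1$ if $C_1(\vec x)_i\le C_1(\vec x)_j$ for all $\vec x\in\{0,1\}^n$. $\mathrm{OGenerate}(R,n)$ is the list of all $C;(i,j)$ with $C\in R$, $i<j<n$, and $(i,j)$ not redundant after $C$. An oracle is a finite list of triples $(C,C',\pi)$ with $C,C'$ networks and $\pi$ a finite list of naturals. A list $\pi=[\pi_0,\ldots,\pi_{m'-1}]$ represents a permutation of $\{0,\ldots,n-1\}$ if $m'=n$, all $\pi_i<n$ and they are pairwise distinct; then $\pi(\vec x)=\vec y$ with $y_{\pi_i}=x_i$, and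 $C\le_\pi C'$ means $\{\pi(\vec x):\vec x\in\mathsf{outputs}(C)\}\subseteq\mathsf{outputs}(C')$. $\mathrm{Prune}(X,R,n)$: if $X$ is empty return $R$; if $X=(C,C',\pi)::X'$, then if $C=C'$, or $C\notin R$, or $\pi$ does not represent a permutation of $\{0,\ldots,n-1\}$, or not $C\le_\pi C'$, return $R$; otherwise return $\mathrm{Prune}(X',R\setminus C',n)$ ($R$ with all occurrences of $C'$ removed). The procedure $\mathrm{GP}(m,n,O)$, with $O$ a list of oracles, returns one of $\mathsf{yes}(p,q)$, $\mathsf{no}(p,q,R)$ ($R$ a list of networks), or $\mathsf{maybe}$, and is defined by recursion on $n$: $\mathrm{GP}(m,0,O)$ is $\mathsf{yes}(0,0)$ if $m=0$, $\mathsf{yes}(1,0)$ if $m=1$, and $\mathsf{no}(m,0,[\emptyset])$ otherwise (where $\emptyset$ is the empty network). $\mathrm{GP}(m,n+1,O)$ is $\mathsf{maybe}$ if $O$ is empty; if $O=X::O'$, let $G=\mathrm{GP}(m,n,O')$: if $G=\mathsf{maybe}$ return $\mathsf{maybe}$; if $G=\mathsf{yes}(p,q)$ return $\mathsf{yes}(p,q)$; if $G=\mathsf{no}(p,q,R)$, let $R'=\mathrm{Prune}(X,\mathrm{OGenerate}(R,p),p)$, and return $\mathsf{yes}(p,q+1)$ if some element of $R'$ is a sorting network on $p$ channels, and $\mathsf{no}(p,q+1,R')$ otherwise. *)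

theory Defs
  imports Main "HOL-Combinatorics.Permutations"
begin

type_synonym comparator = "nat \<times> nat"
type_synonym network = "comparator list"
type_synonym gp_oracle = "(network \<times> network \<times> nat list) list"

definition network_on :: "nat \<Rightarrow> network \<Rightarrow> bool" where
  "network_on n C \<longleftrightarrow> (\<forall>(i, j) \<in> set C. i < n \<and> j < n \<and> i \<noteq> j)"

text \<open>Vectors over {0,1} are Boolean lists, with False for 0 and True for 1;
  the library order on bool has False < True.\<close>

definition bit_vectors :: "nat \<Rightarrow> bool list set" where
  "bit_vectors n = {x. length x = n}"

text \<open>Networks occurring in oracles are arbitrary, so a comparator may address a channel outside
  the vector; by convention it then acts as the identity.\<close>

definition apply_comparator :: "comparator \<Rightarrow> bool list \<Rightarrow> bool list" where
  "apply_comparator = (\<lambda>(i, j) x.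
     if i < length x \<and> j < length x \<and> \<not> x ! i \<le> x ! j
     then x[i := x ! j, j := x ! i] else x)"

definition apply_network :: "network \<Rightarrow> bool list \<Rightarrow> bool list" where
  "apply_network C x = fold apply_comparator C x"

definition outputs :: "nat \<Rightarrow> network \<Rightarrow> bool list set" where
  "outputs n C = apply_network C ` bit_vectors n"

definition sorting_network :: "nat \<Rightarrow> network \<Rightarrow> bool" where
  "sorting_network n C \<longleftrightarrow>
     network_on n C \<and> (\<forall>x \<in> bit_vectors n. sorted (apply_network C x))"

definition redundant_after :: "nat \<Rightarrow> network \<Rightarrow> comparator \<Rightarrow> bool" where
  "redundant_after n C = (\<lambda>(i, j).
     \<forall>x \<in> bit_vectors n. apply_network C x ! i \<le> apply_network C x ! j)"

definition OGenerate :: "network list \<Rightarrow> nat \<Rightarrow> network list" where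
  "OGenerate R n =
     [C @ [(i, j)]. C \<leftarrow> R, i \<leftarrow> [0..<n], j \<leftarrow> [Suc i..<n], \<not> redundant_after n C (i, j)]"

definition represents_permutation :: "nat \<Rightarrow> nat list \<Rightarrow> bool" where
  "represents_permutation n \<pi> \<longleftrightarrow>
     length \<pi> = n \<and> (\<forall>i < n. \<pi> ! i < n) \<and> distinct \<pi>"

text \<open>The entry of x at position i moves to position \<pi>(i), whereas the library's
  permute_list pulls entries back; hence the inverse.\<close>

definition permute_vector :: "nat list \<Rightarrow> bool list \<Rightarrow> bool list" where
  "permute_vector \<pi> x = permute_list (inv_into {..<length \<pi>} ((!) \<pi>)) x"

lemma permute_vector_nth:
  assumes "represents_permutation n \<pi>" "x \<in> bit_vectors n" "i < n"
  shows "permute_vector \<pi> x ! (\<pi> ! i) = x ! i"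
proof -
  have "inj_on ((!) \<pi>) {..<length \<pi>}"
    using assms(1) by (auto simp: represents_permutation_def inj_on_def nth_eq_iff_index_eq)
  then have "inv_into {..<length \<pi>} ((!) \<pi>) (\<pi> ! i) = i"
    using assms by (intro inv_into_f_f) (auto simp: represents_permutation_def)
  then show ?thesis
    using assms
    by (simp add: permute_vector_def permute_list_def represents_permutation_def bit_vectors_def)
qed

definition subsumes :: "nat \<Rightarrow> nat list \<Rightarrow> network \<Rightarrow> network \<Rightarrow> bool" where
  "subsumes n \<pi> C C' \<longleftrightarrow> permute_vector \<pi> ` outputs n C \<subseteq> outputs n C'"

fun Prune :: "gp_oracle \<Rightarrow> network list \<Rightarrow> nat \<Rightarrow> network list" where
  "Prune [] R n = R"
| "Prune ((C, C', \<pi>) # X) R n =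
     (if C = C' \<or> C \<notin> set R \<or> \<not> represents_permutation n \<pi> \<or> \<not> subsumes n \<pi> C C'
      then R
      else Prune X (removeAll C' R) n)"

datatype answer = Yes nat nat | No nat nat "network list" | Maybe

fun GP :: "nat \<Rightarrow> nat \<Rightarrow> gp_oracle list \<Rightarrow> answer" where
  "GP m 0 Os = (if m = 0 then Yes 0 0 else if m = 1 then Yes 1 0 else No m 0 [[]])"
| "GP m (Suc n) [] = Maybe"
| "GP m (Suc n) (X # Os) =
     (case GP m n Os of
        Maybe \<Rightarrow> Maybe
      | Yes p q \<Rightarrow> Yes p q
      | No p q R \<Rightarrow>
          (let R' = Prune X (OGenerate R p) p
           in if \<exists>C \<in> set R'. sorting_network p C then Yes p (q + 1) else No p (q + 1) R'))"

end

theory Submission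
  imports Defs
begin

text \<open>Call a network a sorter up to a permutation if some fixed permutation of the channels sorts all
  its outputs. The argument works with the least number L of comparators of such a network rather
  than of a sorting network. This notion is stable under the two operations of the algorithm:
  pruning with respect to a permutation only changes the permutation of the channels, and a
  comparator (i, j) with i > j acts as (j, i) followed by a transposition, which can be pushed to
  the end of the network. Hence, as long as the answer is negative after q rounds, some surviving
  candidate extends to an optimal sorter up to a permutation by at most L - q comparators.
  A standard network fixes sorted vectors, so it sorts as soon as it sorts up to a permutation;
  therefore the search stops exactly at q = L.\<close>

definition standard_network :: "nat \<Rightarrow> network \<Rightarrow> bool" where
  "standard_network n C \<longleftrightarrow> (\<forall>(i, j) \<in> set C. i < j \<and> j < n)"

text \<open>The list \<open>D\<close> is arbitrary: reversed comparators are allowed and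
  out-of-range ones act as the identity, so relabelling the channels of \<open>D\<close> stays
  within the notion. For \<open>C = []\<close> this describes the sorters up to a permutation with
  at most \<open>d\<close> comparators.\<close>

definition completable :: "nat \<Rightarrow> nat \<Rightarrow> network \<Rightarrow> bool" where
  "completable n d C \<longleftrightarrow> (\<exists>D \<sigma>. length D \<le> d \<and> \<sigma> permutes {..<n} \<and>
     (\<forall>y \<in> outputs n C. sorted (permute_list \<sigma> (apply_network D y))))"

section \<open>Comparators and networks as maps on vectors\<close>

lemma apply_network_Nil [simp]: "apply_network [] x = x"
  by (simp add: apply_network_def)

lemma apply_network_Cons [simp]:
  "apply_network (c # C) x = apply_network C (apply_comparator c x)"
  by (simp add: apply_network_def)

lemma apply_network_append [simp]:
  "apply_network (C @ D) x = apply_network D (apply_network C x)"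
  by (simp add: apply_network_def)

lemma length_apply_comparator [simp]: "length (apply_comparator c x) = length x"
  by (cases c) (simp add: apply_comparator_def)

lemma length_apply_network [simp]: "length (apply_network C x) = length x"
  by (induction C arbitrary: x) simp_all

lemma length_outputs: "y \<in> outputs n C \<Longrightarrow> length y = n"
  by (auto simp: outputs_def bit_vectors_def)

lemma outputs_Nil [simp]: "outputs n [] = bit_vectors n"
  by (simp add: outputs_def)

lemma outputs_append: "outputs n (C @ D) = apply_network D ` outputs n C"
  by (auto simp: outputs_def)

text \<open>On Booleans, minimum and maximum are conjunction and disjunction; the formula remains
  correct for \<open>i = j\<close>.\<close>

lemma apply_comparator_nth:
  assumes "i < length x" "j < length x" "k < length x"
  shows "apply_comparator (i, j) x ! k =
    (if k = i then x ! i \<and> x ! j else if k = j then x ! i \<or> x ! j else x ! k)"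
  using assms by (auto simp: apply_comparator_def nth_list_update)

lemma apply_comparator_outside:
  "\<not> (i < length x \<and> j < length x \<and> i \<noteq> j) \<Longrightarrow> apply_comparator (i, j) x = x"
  by (auto simp: apply_comparator_def)

lemma apply_comparator_ordered: "x ! i \<le> x ! j \<Longrightarrow> apply_comparator (i, j) x = x"
  by (auto simp: apply_comparator_def)

section \<open>Relabelling of channels\<close>

text \<open>Entry \<open>k\<close> of the permuted vector is entry \<open>\<sigma> k\<close> of
  \<open>x\<close>, so comparing after the permutation amounts to comparing the relabelled channels
  before it. As \<open>\<sigma>\<close> preserves the index range, an out-of-range comparator is the
  identity on both sides.\<close>

lemma apply_comparator_permute_list:
  assumes \<sigma>: "\<sigma> permutes {..<length x}"
  shows "apply_comparator (i, j) (permute_list \<sigma> x) =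
    permute_list \<sigma> (apply_comparator (\<sigma> i, \<sigma> j) x)"
proof (cases "i < length x \<and> j < length x")
  case True
  have lt: "\<sigma> k < length x \<longleftrightarrow> k < length x" for k
    using permutes_in_image[OF \<sigma>, of k] by simp
  have eq: "\<sigma> k = \<sigma> l \<longleftrightarrow> k = l" for k l
    using permutes_inj[OF \<sigma>] by (auto dest: injD)
  show ?thesis
  proof (rule nth_equalityI)
    fix k assume "k < length (apply_comparator (i, j) (permute_list \<sigma> x))"
    then have "k < length x" by simp
    with True show "apply_comparator (i, j) (permute_list \<sigma> x) ! k =
        permute_list \<sigma> (apply_comparator (\<sigma> i, \<sigma> j) x) ! k"
      using \<sigma> by (simp add: apply_comparator_nth permute_list_nth lt eq)
  qed simp
next
  case False
  moreover have "\<not> (\<sigma> i < length x \<and> \<sigma> j < length x)"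
    using False permutes_in_image[OF \<sigma>, of i] permutes_in_image[OF \<sigma>, of j] by simp
  ultimately show ?thesis
    by (subst (1 2) apply_comparator_outside) auto
qed

text \<open>This moves a permutation from the input of a network to its output at the price of
  relabelling the comparators. Both the treatment of reversed comparators and that of pruning rest
  on it.\<close>

lemma apply_network_permute_list:
  assumes "\<sigma> permutes {..<length x}"
  shows "apply_network D (permute_list \<sigma> x) =
    permute_list \<sigma> (apply_network (map (map_prod \<sigma> \<sigma>) D) x)"
  using assms
proof (induction D arbitrary: x)
  case (Cons c D)
  then show ?case
    by (cases c) (simp add: apply_comparator_permute_list)
qed simp

text \<open>The two orientations put minimum and maximum on opposite channels, so they differ by the
  exchange of these channels.\<close>

lemma apply_comparator_swap:
  assumes "i < length x" "j < length x"
  shows "apply_comparator (i, j) x =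
    permute_list (Transposition.transpose i j) (apply_comparator (j, i) x)"
proof (rule nth_equalityI)
  have p: "Transposition.transpose i j permutes {..<length x}"
    using assms by (intro permutes_swap_id) auto
  fix k assume "k < length (apply_comparator (i, j) x)"
  then have k: "k < length x" by simp
  then have "Transposition.transpose i j k < length x"
    using permutes_in_image[OF p, of k] by simp
  with assms k p show "apply_comparator (i, j) x ! k =
      permute_list (Transposition.transpose i j) (apply_comparator (j, i) x) ! k"
    by (auto simp: permute_list_nth apply_comparator_nth Transposition.transpose_def
        split: if_splits)
qed simp

section \<open>Standard networks that sort up to a permutation\<close>

lemma standard_network_sorted:
  assumes "standard_network (length x) C" "sorted x"
  shows "apply_network C x = x"
  using assms
proof (induction C)
  case (Cons c C)
  obtain i j where c: "c = (i, j)" by fastforce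
  with Cons.prems have "i \<le> j" "j < length x"
    by (auto simp: standard_network_def)
  then have "x ! i \<le> x ! j"
    using Cons.prems(2) by (rule sorted_nth_mono[rotated])
  with Cons c show ?case
    by (simp add: apply_comparator_ordered standard_network_def)
qed simp

lemma permute_list_inject:
  assumes \<sigma>: "\<sigma> permutes {..<length x}" and len: "length y = length x"
    and eq: "permute_list \<sigma> x = permute_list \<sigma> y"
  shows "x = y"
proof -
  have inverse: "permute_list (inv \<sigma>) (permute_list \<sigma> z) = z"
    if "length z = length x" for z :: "'a list"
  proof -
    have "permute_list (inv \<sigma>) (permute_list \<sigma> z) = permute_list (\<sigma> \<circ> inv \<sigma>) z"
      using permutes_inv[OF \<sigma>] that by (simp add: permute_list_compose)
    then show ?thesis
      by (simp only: permutes_inv_o(1)[OF \<sigma>] permute_list_id)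
  qed
  have "x = permute_list (inv \<sigma>) (permute_list \<sigma> x)"
    by (rule inverse[OF refl, symmetric])
  also have "\<dots> = y"
    unfolding eq by (rule inverse[OF len])
  finally show ?thesis .
qed

lemma completable_0_imp_sorting_network:
  assumes std: "standard_network n C" and compl: "completable n 0 C"
  shows "sorting_network n C"
  unfolding sorting_network_def
proof
  show "network_on n C"
    using std by (fastforce simp: network_on_def standard_network_def)
  obtain \<sigma> where \<sigma>: "\<sigma> permutes {..<n}"
    and sort: "\<And>x. length x = n \<Longrightarrow> sorted (permute_list \<sigma> (apply_network C x))"
    using compl by (auto simp: completable_def outputs_def bit_vectors_def)
  show "\<forall>x \<in> bit_vectors n. sorted (apply_network C x)"
  proof
    fix x :: "bool list" assume "x \<in> bit_vectors n"
    then have len: "length x = n" by (simp add: bit_vectors_def)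
    \<comment> \<open>The sorted vector \<open>s\<close> is itself a possible input. The standard
      network fixes it, so permuting \<open>s\<close> by \<open>\<sigma>\<close> yields a sorted
      vector. This is a sorted rearrangement of \<open>s\<close>, hence \<open>s\<close> itself, and
      cancelling \<open>\<sigma>\<close> identifies \<open>s\<close> with the output on
      \<open>x\<close>.\<close>
    define s where "s = permute_list \<sigma> (apply_network C x)"
    have s: "sorted s" "length s = n"
      using sort[OF len] len by (simp_all add: s_def)
    have "sorted (permute_list \<sigma> s)"
      using sort[OF s(2)] standard_network_sorted[of s C] std s by simp
    moreover have "mset (permute_list \<sigma> s) = mset s"
      using \<sigma> s(2) by (simp add: mset_permute_list)
    ultimately have "sort s = permute_list \<sigma> s"
      by (intro properties_for_sort)
    moreover have "sort s = s"
      using s(1) by (rule sorted_sort_id)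
    ultimately have "permute_list \<sigma> s = s"
      by (rule subst)
    also have "s = permute_list \<sigma> (apply_network C x)" by (rule s_def)
    finally have "s = apply_network C x"
      by (rule permute_list_inject[rotated 2]) (use \<sigma> s(2) len in simp_all)
    with s show "sorted (apply_network C x)" by simp
  qed
qed

section \<open>Completability and its first comparator\<close>

lemma sorting_network_imp_completable:
  "sorting_network n C \<Longrightarrow> completable n (length C) []"
  unfolding completable_def sorting_network_def
  by (intro exI[of _ C] exI[of _ id]) (auto simp: permutes_id)

text \<open>This bounds \<open>d\<close> from below: a network with \<open>q\<close> comparators
  cannot be completed by fewer than \<open>L - q\<close>, where \<open>L\<close> is the optimum for
  the empty network.\<close>

lemma completable_imp_completable_Nil:
  assumes "completable n d C"
  shows "completable n (length C + d) []"
proof -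
  obtain D \<sigma> where D: "length D \<le> d" "\<sigma> permutes {..<n}"
    "\<forall>y \<in> outputs n C. sorted (permute_list \<sigma> (apply_network D y))"
    using assms by (auto simp: completable_def)
  then show ?thesis
    unfolding completable_def
    by (intro exI[of _ "C @ D"] exI[of _ \<sigma>]) (auto simp: outputs_def)
qed

lemma completable_Suc:
  assumes "completable n (Suc d) C"
  shows "completable n d C \<or>
    (\<exists>i j. i < j \<and> j < n \<and> \<not> redundant_after n C (i, j) \<and> completable n d (C @ [(i, j)]))"
proof -
  \<comment> \<open>A correctly oriented first comparator is dropped if redundant and appended to
    \<open>C\<close> otherwise.\<close>
  have ordered: ?thesis
    if "length D \<le> d" "\<sigma> permutes {..<n}" "i < j" "j < n"
      and sort: "\<And>y. y \<in> outputs n C \<Longrightarrow>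
        sorted (permute_list \<sigma> (apply_network D (apply_comparator (i, j) y)))"
    for D \<sigma> i j
  proof (cases "redundant_after n C (i, j)")
    case True
    then have fixed: "apply_comparator (i, j) y = y" if "y \<in> outputs n C" for y
      using that by (intro apply_comparator_ordered) (auto simp: redundant_after_def outputs_def)
    have "sorted (permute_list \<sigma> (apply_network D y))" if "y \<in> outputs n C" for y
      using sort[OF that] fixed[OF that] by simp
    with that(1,2) have "completable n d C"
      unfolding completable_def by blast
    then show ?thesis ..
  next
    case False
    have "completable n d (C @ [(i, j)])"
      unfolding completable_def using that(1,2) sort
      by (intro exI[of _ D] exI[of _ \<sigma>]) (simp add: outputs_append)
    with False that(3,4) show ?thesis by blast
  qed
  obtain E \<sigma> where E: "length E \<le> Suc d" "\<sigma> permutes {..<n}"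
    and sort: "\<And>y. y \<in> outputs n C \<Longrightarrow> sorted (permute_list \<sigma> (apply_network E y))"
    using assms by (auto simp: completable_def)
  show ?thesis
  proof (cases E)
    case Nil
    then have "completable n d C"
      unfolding completable_def using E sort by (intro exI[of _ "[]"] exI[of _ \<sigma>]) auto
    then show ?thesis ..
  next
    case (Cons c D)
    obtain i j where c: "c = (i, j)" by fastforce
    have D: "length D \<le> d" using E Cons by simp
    have sort': "sorted (permute_list \<sigma> (apply_network D (apply_comparator (i, j) y)))"
      if "y \<in> outputs n C" for y
      using sort[OF that] Cons c by simp
    consider "\<not> (i < n \<and> j < n \<and> i \<noteq> j)" | "i < j" "j < n" | "j < i" "i < n"
      by linarith
    then show ?thesis
    proof cases
      case 1
      then have fixed: "apply_comparator (i, j) y = y" if "y \<in> outputs n C" for y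
        using length_outputs[OF that] by (intro apply_comparator_outside) simp
      have "sorted (permute_list \<sigma> (apply_network D y))" if "y \<in> outputs n C" for y
        using sort'[OF that] fixed[OF that] by simp
      with D E(2) have "completable n d C"
        unfolding completable_def by blast
      then show ?thesis ..
    next
      case 2
      with ordered D E(2) sort' show ?thesis by blast
    next
      \<comment> \<open>The reversed comparator is \<open>(j, i)\<close> followed by the
        transposition \<open>\<tau>\<close>, which passes through \<open>D\<close> by relabelling
        and is absorbed into the final permutation.\<close>
      case 3
      define \<tau> where "\<tau> = Transposition.transpose i j"
      have \<tau>: "\<tau> permutes {..<n}"
        unfolding \<tau>_def using 3 by (intro permutes_swap_id) auto
      show ?thesis
      proof (rule ordered)
        show "length (map (map_prod \<tau> \<tau>) D) \<le> d" using D by simp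
        show "\<tau> \<circ> \<sigma> permutes {..<n}" using E(2) \<tau> by (rule permutes_compose)
        fix y assume y: "y \<in> outputs n C"
        note len = length_outputs[OF y]
        let ?z = "apply_comparator (j, i) y"
        have "apply_comparator (i, j) y = permute_list \<tau> ?z"
          unfolding \<tau>_def using 3 len by (intro apply_comparator_swap) auto
        then have "permute_list \<sigma> (apply_network D (apply_comparator (i, j) y)) =
            permute_list \<sigma> (permute_list \<tau> (apply_network (map (map_prod \<tau> \<tau>) D) ?z))"
          using \<tau> len by (simp add: apply_network_permute_list)
        also have "\<dots> = permute_list (\<tau> \<circ> \<sigma>) (apply_network (map (map_prod \<tau> \<tau>) D) ?z)"
          using E(2) len by (simp add: permute_list_compose)
        finally show "sorted (permute_list (\<tau> \<circ> \<sigma>) (apply_network (map (map_prod \<tau> \<tau>) D) ?z))"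
          using sort'[OF y] by simp
      qed (use 3 in auto)
    qed
  qed
qed

section \<open>Pruning\<close>

lemma permute_vector_eq_permute_list:
  assumes "represents_permutation n \<pi>"
  obtains \<rho> where "\<rho> permutes {..<n}" "\<And>x. length x = n \<Longrightarrow> permute_vector \<pi> x = permute_list \<rho> x"
proof
  let ?f = "inv_into {..<length \<pi>} ((!) \<pi>)"
  \<comment> \<open>Outside the index range \<open>inv_into\<close> is unspecified, whereas
    \<open>permutes\<close> demands the identity there.\<close>
  let ?\<rho> = "\<lambda>i. if i < n then ?f i else i"
  have len: "length \<pi> = n" using assms by (simp add: represents_permutation_def)
  have inj: "inj_on ((!) \<pi>) {..<n}"
    using assms by (auto simp: represents_permutation_def inj_on_def nth_eq_iff_index_eq)
  moreover have "(!) \<pi> ` {..<n} \<subseteq> {..<n}"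
    using assms by (auto simp: represents_permutation_def)
  ultimately have "bij_betw ((!) \<pi>) {..<n} {..<n}"
    by (simp add: bij_betw_def endo_inj_surj)
  then have "bij_betw ?f {..<n} {..<n}"
    using len by (simp add: bij_betw_inv_into)
  then have "bij_betw ?\<rho> {..<n} {..<n}"
    by (rule bij_betw_cong[THEN iffD1, rotated]) auto
  then show "?\<rho> permutes {..<n}"
    by (intro bij_imp_permutes) auto
  show "permute_vector \<pi> x = permute_list ?\<rho> x" if "length x = n" for x
    using that by (auto simp: permute_vector_def permute_list_def)
qed

text \<open>The permuted outputs of \<open>C\<close> are among those of \<open>C'\<close>, so a
  completion of \<open>C'\<close> sorts them; the permutation then moves past the relabelled
  completion. Hence \<open>C'\<close> may be discarded in favour of \<open>C\<close>.\<close>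

lemma subsumes_completable:
  assumes \<pi>: "represents_permutation n \<pi>" and sub: "subsumes n \<pi> C C'"
    and compl: "completable n d C'"
  shows "completable n d C"
proof -
  obtain \<rho> where \<rho>: "\<rho> permutes {..<n}"
    and \<pi>_\<rho>: "\<And>x. length x = n \<Longrightarrow> permute_vector \<pi> x = permute_list \<rho> x"
    using permute_vector_eq_permute_list[OF \<pi>] by blast
  obtain D \<sigma> where D: "length D \<le> d" and \<sigma>: "\<sigma> permutes {..<n}"
    and sort: "\<And>y. y \<in> outputs n C' \<Longrightarrow> sorted (permute_list \<sigma> (apply_network D y))"
    using compl by (auto simp: completable_def)
  have "sorted (permute_list (\<rho> \<circ> \<sigma>) (apply_network (map (map_prod \<rho> \<rho>) D) y))"
    if y: "y \<in> outputs n C" for y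
  proof -
    note len = length_outputs[OF y]
    have "permute_list \<rho> y \<in> outputs n C'"
      using sub y \<pi>_\<rho>[OF len] by (auto simp: subsumes_def)
    from sort[OF this] show ?thesis
      using \<rho> \<sigma> len by (simp add: apply_network_permute_list permute_list_compose)
  qed
  with D permutes_compose[OF \<sigma> \<rho>] show ?thesis
    unfolding completable_def
    by (intro exI[of _ "map (map_prod \<rho> \<rho>) D"] exI[of _ "\<rho> \<circ> \<sigma>"]) simp
qed

lemma set_Prune_subset: "set (Prune X R n) \<subseteq> set R"
proof (induction X R n rule: Prune.induct)
  case (2 C C' \<pi> X R n)
  show ?case
  proof (cases "C = C' \<or> C \<notin> set R \<or> \<not> represents_permutation n \<pi> \<or> \<not> subsumes n \<pi> C C'")
    case False
    then have "set (Prune X (removeAll C' R) n) \<subseteq> set (removeAll C' R)" by (rule 2)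
    with False show ?thesis by auto
  qed simp
qed simp

lemma Prune_completable:
  "\<exists>C \<in> set R. completable n d C \<Longrightarrow> \<exists>C \<in> set (Prune X R n). completable n d C"
proof (induction X R n rule: Prune.induct)
  case (2 C C' \<pi> X R n)
  show ?case
  proof (cases "C = C' \<or> C \<notin> set R \<or> \<not> represents_permutation n \<pi> \<or> \<not> subsumes n \<pi> C C'")
    case True
    with 2 show ?thesis by simp
  next
    case False
    \<comment> \<open>If the witness was \<open>C'\<close>, then \<open>C\<close> replaces it: it
      lies in \<open>R\<close> and survives the removal because
      \<open>C \<noteq> C'\<close>.\<close>
    have "\<exists>B \<in> set (removeAll C' R). completable n d B"
      using "2.prems" False subsumes_completable[of n \<pi> C C' d] by auto
    with False "2.IH" show ?thesis by auto
  qed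
qed simp

section \<open>Invariants of the search\<close>

lemma set_OGenerate:
  "set (OGenerate R n) =
    {C @ [(i, j)] |C i j. C \<in> set R \<and> i < j \<and> j < n \<and> \<not> redundant_after n C (i, j)}"
  by (fastforce simp: OGenerate_def)

lemma sorting_network_Nil_iff: "sorting_network m [] \<longleftrightarrow> m \<le> 1"
proof
  assume sort: "sorting_network m []"
  show "m \<le> 1"
  proof (rule ccontr)
    assume "\<not> m \<le> 1"
    then have "True # replicate (m - 1) False \<in> bit_vectors m" "0 < m - 1"
      by (auto simp: bit_vectors_def)
    with sort have "sorted (True # replicate (m - 1) False)"
      by (auto simp: sorting_network_def)
    with \<open>0 < m - 1\<close> show False by simp
  qed
next
  assume "m \<le> 1"
  then show "sorting_network m []"
    by (auto simp: sorting_network_def network_on_def bit_vectors_def sorted01)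
qed

text \<open>The \<open>Yes\<close> case is the existence half of the result. The facts recorded for
  \<open>No\<close> serve the lower bound, where a candidate that does not sort must still lack a
  comparator.\<close>

lemma GP_sound:
  "case GP m n Os of
      Yes p q \<Rightarrow> p = m \<and> (\<exists>C. sorting_network m C \<and> length C = q)
    | No p q R \<Rightarrow> p = m \<and>
        (\<forall>C \<in> set R. standard_network m C \<and> length C = q \<and> \<not> sorting_network m C)
    | Maybe \<Rightarrow> True"
proof (induction n arbitrary: Os)
  case 0
  show ?case
    by (simp add: standard_network_def sorting_network_Nil_iff)
next
  case (Suc n)
  show ?case
  proof (cases Os)
    case (Cons X Os')
    show ?thesis
    proof (cases "GP m n Os'")
      case (No p q R)
      define R' where "R' = Prune X (OGenerate R m) m"
      have "p = m" and R: "\<forall>C \<in> set R. standard_network m C \<and> length C = q"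
        using Suc[of Os'] No by auto
      then have GP: "GP m (Suc n) Os = (if \<exists>C \<in> set R'. sorting_network m C
          then Yes m (Suc q) else No m (Suc q) R')"
        by (simp add: Cons No R'_def Let_def)
      have "\<forall>C \<in> set (OGenerate R m). standard_network m C \<and> length C = Suc q"
        using R by (fastforce simp: set_OGenerate standard_network_def)
      then have "\<forall>C \<in> set R'. standard_network m C \<and> length C = Suc q"
        using set_Prune_subset R'_def by blast
      with GP show ?thesis by auto
    qed (use Suc[of Os'] Cons in auto)
  qed simp
qed

lemma GP_optimal:
  assumes L0: "completable m L []" and L: "\<And>d. completable m d [] \<Longrightarrow> L \<le> d"
  shows "case GP m n Os of
      Yes p q \<Rightarrow> q \<le> L
    | No p q R \<Rightarrow> q \<le> L \<and> (\<exists>C \<in> set R. completable m (L - q) C)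
    | Maybe \<Rightarrow> True"
proof (induction n arbitrary: Os)
  case 0
  show ?case
    using L0 by simp
next
  case (Suc n)
  show ?case
  proof (cases Os)
    case (Cons X Os')
    show ?thesis
    proof (cases "GP m n Os'")
      case (No p q R)
      define R' where "R' = Prune X (OGenerate R m) m"
      have "p = m" using GP_sound[of m n Os'] No by simp
      then have GP: "GP m (Suc n) Os = (if \<exists>C \<in> set R'. sorting_network m C
          then Yes m (Suc q) else No m (Suc q) R')"
        by (simp add: Cons No R'_def Let_def)
      obtain C where C: "C \<in> set R" "completable m (L - q) C" and "q \<le> L"
        using Suc[of Os'] No by auto
      have std: "standard_network m C" "length C = q" "\<not> sorting_network m C"
        using GP_sound[of m n Os'] No C(1) by auto
      \<comment> \<open>At \<open>q = L\<close> the candidate would already sort up to a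
        permutation, and being standard it would sort.\<close>
      with C(2) have "L - q \<noteq> 0"
        using completable_0_imp_sorting_network[of m C] by (intro notI) simp
      then have q: "Suc q \<le> L" by simp
      have "\<not> completable m (L - Suc q) C"
        using completable_imp_completable_Nil[of m "L - Suc q" C] L[of "q + (L - Suc q)"] std(2) q
        by auto
      moreover have "completable m (Suc (L - Suc q)) C"
        using C(2) q by (simp add: Suc_diff_Suc)
      ultimately have "\<exists>B \<in> set (OGenerate R m). completable m (L - Suc q) B"
        using completable_Suc[of m "L - Suc q" C] C(1) by (auto simp: set_OGenerate)
      then have "\<exists>B \<in> set R'. completable m (L - Suc q) B"
        unfolding R'_def by (rule Prune_completable)
      with GP q show ?thesis by auto
    qed (use Suc[of Os'] Cons in auto)
  qed simp
qed

theorem mainTheorem6: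
  fixes m n k :: nat and Os :: "gp_oracle list"
  assumes "GP m n Os = Yes m k"
  shows "(\<forall>C. sorting_network m C \<longrightarrow> length C \<ge> k) \<and>
         (\<exists>C. sorting_network m C \<and> length C = k)"
proof
  show "\<exists>C. sorting_network m C \<and> length C = k"
    using GP_sound[of m n Os] assms by simp
  show "\<forall>C. sorting_network m C \<longrightarrow> length C \<ge> k"
  proof (intro allI impI)
    fix C assume "sorting_network m C"
    then have C: "completable m (length C) []"
      by (rule sorting_network_imp_completable)
    \<comment> \<open>The given sorting network is a sorter up to a permutation, so the minimum is
      taken over a nonempty set and is at most \<open>length C\<close>.\<close>
    define L where "L = (LEAST d. completable m d [])"
    have "k \<le> L"
      using GP_optimal[of m L n Os] LeastI[of "\<lambda>d. completable m d []", OF C] assms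
      by (simp add: L_def Least_le)
    also have "L \<le> length C"
      unfolding L_def using C by (rule Least_le)
    finally show "k \<le> length C" .
  qed
qed

end
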